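(* Let $I$ and $J$ be two ideals of a reduced commutative ring $R$ such that $R/I$ is a flat $R$-module and $V(I)=V(J)$. Then $I=J$.
   Context: All rings are commutative with identity. For an ideal $I$ of $R$, $V(I)=\{\mathfrak{p}\in\operatorname{Spec}(R): I\subseteq\mathfrak{p}\}$. *)

theory Defs
  imports "HOL-Algebra.Algebra" "HOL-Algebra.Free_Abelian_Groups"
begin

definition reduced_ring :: "('a, 'm) ring_scheme \<Rightarrow> bool" where
  "reduced_ring R \<longleftrightarrow>
     cring R \<and> (\<forall>x\<in>carrier R. \<forall>n::nat. x [^]\<^bsub>R\<^esub> n = \<zero>\<^bsub>R\<^esub> \<longrightarrow> x = \<zero>\<^bsub>R\<^esub>)"

definition Spec :: "('a, 'm) ring_scheme \<Rightarrow> 'a set set" where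
  "Spec R = {P. primeideal P R}"

definition zero_locus :: "('a, 'm) ring_scheme \<Rightarrow> 'a set \<Rightarrow> 'a set set" where
  "zero_locus R I = {P \<in> Spec R. I \<subseteq> P}"

text \<open>The \<open>R\<close>-module \<open>R/I\<close>: the additive group of \<open>R Quot I\<close>, on which \<open>r\<close> acts as
  multiplication by its residue class.\<close>

definition quotient_module :: "('a, 'm) ring_scheme \<Rightarrow> 'a set \<Rightarrow> ('a, 'a set) module" where
  "quotient_module R I =
     ring.extend (R Quot I) (module.fields (\<lambda>r x. (I +>\<^bsub>R\<^esub> r) \<otimes>\<^bsub>R Quot I\<^esub> x))"

definition module_homs ::
  "('a, 'm) ring_scheme \<Rightarrow> ('a, 'b, 'p) module_scheme \<Rightarrow> ('a, 'c, 'q) module_scheme \<Rightarrow> ('b \<Rightarrow> 'c) set"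
  where
  "module_homs R N N' =
     {f \<in> carrier N \<rightarrow> carrier N'.
        (\<forall>x\<in>carrier N. \<forall>y\<in>carrier N. f (x \<oplus>\<^bsub>N\<^esub> y) = f x \<oplus>\<^bsub>N'\<^esub> f y) \<and>
        (\<forall>r\<in>carrier R. \<forall>x\<in>carrier N. f (r \<odot>\<^bsub>N\<^esub> x) = r \<odot>\<^bsub>N'\<^esub> f x)}"

text \<open>\<open>N \<otimes>\<^sub>R M\<close> as an abelian group: the free abelian group on \<open>N \<times> M\<close> modulo the subgroup
  generated by the bilinearity relations. Elements of the free group are written additively
  (type \<open>\<Rightarrow>\<^sub>0\<close>), although \<open>free_Abelian_group\<close> is a multiplicative record.\<close>

definition tensor_free ::
  "('a, 'b, 'p) module_scheme \<Rightarrow> ('a, 'c, 'q) module_scheme \<Rightarrow> ('b \<times> 'c \<Rightarrow>\<^sub>0 int) monoid" where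
  "tensor_free N M = free_Abelian_group (carrier N \<times> carrier M)"

definition tensor_relations ::
  "('a, 'm) ring_scheme \<Rightarrow> ('a, 'b, 'p) module_scheme \<Rightarrow> ('a, 'c, 'q) module_scheme
    \<Rightarrow> ('b \<times> 'c \<Rightarrow>\<^sub>0 int) set" where
  "tensor_relations R N M =
     {frag_of (x \<oplus>\<^bsub>N\<^esub> x', y) - frag_of (x, y) - frag_of (x', y) | x x' y.
        x \<in> carrier N \<and> x' \<in> carrier N \<and> y \<in> carrier M} \<union>
     {frag_of (x, y \<oplus>\<^bsub>M\<^esub> y') - frag_of (x, y) - frag_of (x, y') | x y y'.
        x \<in> carrier N \<and> y \<in> carrier M \<and> y' \<in> carrier M} \<union>
     {frag_of (r \<odot>\<^bsub>N\<^esub> x, y) - frag_of (x, r \<odot>\<^bsub>M\<^esub> y) | r x y.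
        r \<in> carrier R \<and> x \<in> carrier N \<and> y \<in> carrier M}"

definition tensor_kernel ::
  "('a, 'm) ring_scheme \<Rightarrow> ('a, 'b, 'p) module_scheme \<Rightarrow> ('a, 'c, 'q) module_scheme
    \<Rightarrow> ('b \<times> 'c \<Rightarrow>\<^sub>0 int) set" where
  "tensor_kernel R N M = generate (tensor_free N M) (tensor_relations R N M)"

definition tensor_product ::
  "('a, 'm) ring_scheme \<Rightarrow> ('a, 'b, 'p) module_scheme \<Rightarrow> ('a, 'c, 'q) module_scheme
    \<Rightarrow> ('b \<times> 'c \<Rightarrow>\<^sub>0 int) set monoid" where
  "tensor_product R N M = tensor_free N M Mod tensor_kernel R N M"

text \<open>The map \<open>f \<otimes> id : N \<otimes>\<^sub>R M \<rightarrow> N' \<otimes>\<^sub>R M\<close> induced by an \<open>R\<close>-linear \<open>f : N \<rightarrow> N'\<close>.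
  The pointwise image of a coset under the map of free groups lies in a single coset of the
  target, and multiplying by the target's subgroup fills up that coset: see
  \<open>tensor_map_coset\<close> below.\<close>

definition tensor_map ::
  "('a, 'm) ring_scheme \<Rightarrow> ('a, 'b, 'p) module_scheme \<Rightarrow> ('a, 'c, 'q) module_scheme \<Rightarrow> ('d \<Rightarrow> 'b)
    \<Rightarrow> ('d \<times> 'c \<Rightarrow>\<^sub>0 int) set \<Rightarrow> ('b \<times> 'c \<Rightarrow>\<^sub>0 int) set" where
  "tensor_map R N' M f T =
     tensor_kernel R N' M <#>\<^bsub>tensor_free N' M\<^esub> (frag_extend (frag_of \<circ> map_prod f id) ` T)"

text \<open>\<open>M\<close> is flat if \<open>_ \<otimes>\<^sub>R M\<close> preserves injectivity. The test modules \<open>N\<close>, \<open>N'\<close> must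
  live in some fixed type; every countably generated \<open>R\<close>-module, being a quotient of the finitely
  supported sequences in \<open>R\<close>, has a copy whose elements are of type \<open>(nat \<Rightarrow> 'a) set\<close>.
  This loses nothing: if an element of \<open>N \<otimes>\<^sub>R M\<close> is killed by \<open>f \<otimes> id\<close>, then for arbitrary
  \<open>N\<close>, \<open>N'\<close> this already happens between finitely generated submodules of \<open>N\<close> and \<open>N'\<close>.\<close>

definition flat_module :: "('a, 'm) ring_scheme \<Rightarrow> ('a, 'c, 'q) module_scheme \<Rightarrow> bool" where
  "flat_module R M \<longleftrightarrow>
     module R M \<and>
     (\<forall>(N :: ('a, (nat \<Rightarrow> 'a) set) module) (N' :: ('a, (nat \<Rightarrow> 'a) set) module) f.
        module R N \<and> module R N' \<and> f \<in> module_homs R N N' \<and> inj_on f (carrier N) \<longrightarrow>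
        inj_on (tensor_map R N' M f) (carrier (tensor_product R N M)))"

lemma quotient_module_simps:
  "carrier (quotient_module R I) = carrier (R Quot I)"
  "x \<oplus>\<^bsub>quotient_module R I\<^esub> y = x \<oplus>\<^bsub>R Quot I\<^esub> y"
  "\<zero>\<^bsub>quotient_module R I\<^esub> = \<zero>\<^bsub>R Quot I\<^esub>"
  "r \<odot>\<^bsub>quotient_module R I\<^esub> x = (I +>\<^bsub>R\<^esub> r) \<otimes>\<^bsub>R Quot I\<^esub> x"
  by (simp_all add: quotient_module_def ring.defs module.defs)

lemma module_quotient_module:
  assumes "cring R" "ideal I R"
  shows "module R (quotient_module R I)"
proof -
  interpret Q: cring "R Quot I"
    by (rule ideal.quotient_is_cring[OF assms(2,1)])
  have h: "(\<lambda>r. I +>\<^bsub>R\<^esub> r) \<in> ring_hom R (R Quot I)"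
    by (rule ideal.rcos_ring_hom[OF assms(2)])
  note [simp] = ring_hom_closed[OF h] ring_hom_add[OF h] ring_hom_mult[OF h] ring_hom_one[OF h]
  have inv: "\<exists>y\<in>carrier (R Quot I). y \<oplus>\<^bsub>R Quot I\<^esub> x = \<zero>\<^bsub>R Quot I\<^esub>"
    if "x \<in> carrier (R Quot I)" for x
    using that Q.l_neg[OF that] Q.a_inv_closed by blast
  show ?thesis
  proof (rule moduleI)
    show "abelian_group (quotient_module R I)"
      by (rule abelian_groupI)
         (simp_all add: quotient_module_simps Q.add.m_ac inv)
  qed (simp_all add: assms(1) quotient_module_simps Q.l_distr Q.r_distr Q.m_assoc)
qed

lemma tensor_free_simps:
  "carrier (tensor_free N M) = {c. Poly_Mapping.keys c \<subseteq> carrier N \<times> carrier M}"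
  "x \<otimes>\<^bsub>tensor_free N M\<^esub> y = x + y"
  "\<one>\<^bsub>tensor_free N M\<^esub> = 0"
  "x \<in> carrier (tensor_free N M) \<Longrightarrow> inv\<^bsub>tensor_free N M\<^esub> x = - x"
  proof -
  show car: "carrier (tensor_free N M) = {c. Poly_Mapping.keys c \<subseteq> carrier N \<times> carrier M}"
    by (simp add: tensor_free_def free_Abelian_group_def)
  show "inv\<^bsub>tensor_free N M\<^esub> x = - x" if "x \<in> carrier (tensor_free N M)"
    using that unfolding car by (simp add: tensor_free_def)
qed (simp_all add: tensor_free_def)

lemma tensor_relations_cases:
  assumes "a \<in> tensor_relations R N M"
  obtains
    (add1) x x' y where "x \<in> carrier N" "x' \<in> carrier N" "y \<in> carrier M"
      "a = frag_of (x \<oplus>\<^bsub>N\<^esub> x', y) - frag_of (x, y) - frag_of (x', y)"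
  | (add2) x y y' where "x \<in> carrier N" "y \<in> carrier M" "y' \<in> carrier M"
      "a = frag_of (x, y \<oplus>\<^bsub>M\<^esub> y') - frag_of (x, y) - frag_of (x, y')"
  | (smult) r x y where "r \<in> carrier R" "x \<in> carrier N" "y \<in> carrier M"
      "a = frag_of (r \<odot>\<^bsub>N\<^esub> x, y) - frag_of (x, r \<odot>\<^bsub>M\<^esub> y)"
  using assms unfolding tensor_relations_def
  apply (elim UnE CollectE exE conjE)
    apply (rule that(1); assumption)
   apply (rule that(2); assumption)
  apply (rule that(3); assumption)
  done

lemma tensor_relations_subset:
  assumes "module R N" "module R M"
  shows "tensor_relations R N M \<subseteq> carrier (tensor_free N M)"
proof
  interpret N: module R N by fact
  interpret M: module R M by fact
  have diff: "Poly_Mapping.keys (a - b) \<subseteq> S"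
    if "Poly_Mapping.keys a \<subseteq> S" "Poly_Mapping.keys b \<subseteq> S"
    for a b :: "'x \<Rightarrow>\<^sub>0 int" and S
    by (rule order_trans[OF keys_diff Un_least[OF that]])
  fix a assume "a \<in> tensor_relations R N M"
  then have "Poly_Mapping.keys a \<subseteq> carrier N \<times> carrier M"
  proof (cases rule: tensor_relations_cases)
    case add1
    show ?thesis
      unfolding add1(4) by (intro diff) (simp_all add: add1(1-3))
  next
    case add2
    show ?thesis
      unfolding add2(4) by (intro diff) (simp_all add: add2(1-3))
  next
    case smult
    show ?thesis
      unfolding smult(4) by (intro diff) (simp_all add: smult(1-3))
  qed
  then show "a \<in> carrier (tensor_free N M)"
    by (simp only: tensor_free_simps mem_Collect_eq)
qed

lemma subgroup_tensor_kernel: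
  assumes "module R N" "module R M"
  shows "subgroup (tensor_kernel R N M) (tensor_free N M)"
  unfolding tensor_kernel_def
  by (rule group.generate_is_subgroup[OF _ tensor_relations_subset[OF assms]])
     (simp add: tensor_free_def)

lemma tensor_map_coset:
  assumes N: "module R N" and N': "module R N'" and M: "module R M"
    and f: "f \<in> module_homs R N N'"
  shows "tensor_map R N' M f (tensor_kernel R N M #>\<^bsub>tensor_free N M\<^esub> c) =
         tensor_kernel R N' M #>\<^bsub>tensor_free N' M\<^esub> frag_extend (frag_of \<circ> map_prod f id) c"
proof -
  let ?g = "frag_extend (frag_of \<circ> map_prod f id)"
  let ?A = "tensor_kernel R N M" and ?B = "tensor_kernel R N' M"
  note subA = subgroup_tensor_kernel[OF N M] and subB = subgroup_tensor_kernel[OF N' M]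
  have A0: "0 \<in> ?A"
    using subgroup.one_closed[OF subA] by (simp add: tensor_free_simps)
  have B0: "0 \<in> ?B"
    using subgroup.one_closed[OF subB] by (simp add: tensor_free_simps)
  have Badd: "a + b \<in> ?B" if "a \<in> ?B" "b \<in> ?B" for a b
    using subgroup.m_closed[OF subB that] by (simp add: tensor_free_simps)
  have Bneg: "- a \<in> ?B" if "a \<in> ?B" for a
    using subgroup.m_inv_closed[OF subB that] subgroup.mem_carrier[OF subB that]
    by (simp add: tensor_free_simps(4))
  have fc: "f x \<in> carrier N'" if "x \<in> carrier N" for x
    using f that by (auto simp: module_homs_def)
  have fa: "f (x \<oplus>\<^bsub>N\<^esub> y) = f x \<oplus>\<^bsub>N'\<^esub> f y" if "x \<in> carrier N" "y \<in> carrier N" for x y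
    using f that by (simp add: module_homs_def)
  have fs: "f (r \<odot>\<^bsub>N\<^esub> x) = r \<odot>\<^bsub>N'\<^esub> f x" if "r \<in> carrier R" "x \<in> carrier N" for r x
    using f that by (simp add: module_homs_def)
  have rel: "?g a \<in> ?B" if "a \<in> tensor_relations R N M" for a
  proof -
    from that have "?g a \<in> tensor_relations R N' M"
    proof (cases rule: tensor_relations_cases)
      case (add1 x x' y)
      then have "?g a = frag_of (f x \<oplus>\<^bsub>N'\<^esub> f x', y) - frag_of (f x, y) - frag_of (f x', y)"
        by (simp add: frag_extend_diff fa)
      with add1 fc show ?thesis unfolding tensor_relations_def by blast
    next
      case (add2 x y y')
      then have "?g a = frag_of (f x, y \<oplus>\<^bsub>M\<^esub> y') - frag_of (f x, y) - frag_of (f x, y')"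
        by (simp add: frag_extend_diff)
      with add2 fc show ?thesis unfolding tensor_relations_def by blast
    next
      case (smult r x y)
      then have "?g a = frag_of (r \<odot>\<^bsub>N'\<^esub> f x, y) - frag_of (f x, r \<odot>\<^bsub>M\<^esub> y)"
        by (simp add: frag_extend_diff fs)
      with smult fc show ?thesis unfolding tensor_relations_def by blast
    qed
    then show ?thesis
      unfolding tensor_kernel_def by (rule generate.incl)
  qed
  have gA: "?g a \<in> ?B" if "a \<in> ?A" for a
    using that unfolding tensor_kernel_def[of R N M]
  proof induction
    case one
    then show ?case by (simp add: tensor_free_simps B0)
  next
    case (incl h)
    then show ?case by (rule rel)
  next
    case (inv h)
    then have "h \<in> carrier (tensor_free N M)"
      using tensor_relations_subset[OF N M] by blast
    then show ?case
      using Bneg[OF rel[OF inv]] by (simp only: tensor_free_simps(4) frag_extend_minus)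
  next
    case (eng h1 h2)
    then show ?case by (simp only: tensor_free_simps frag_extend_add Badd)
  qed
  have "tensor_map R N' M f (?A #>\<^bsub>tensor_free N M\<^esub> c) = {b + ?g (a + c) | a b. a \<in> ?A \<and> b \<in> ?B}"
    unfolding tensor_map_def r_coset_def set_mult_def tensor_free_simps by blast
  also have "\<dots> = {b + ?g c | b. b \<in> ?B}"
  proof (intro equalityI subsetI)
    fix z assume "z \<in> {b + ?g (a + c) | a b. a \<in> ?A \<and> b \<in> ?B}"
    then obtain a b where "a \<in> ?A" "b \<in> ?B" "z = (b + ?g a) + ?g c"
      by (auto simp: frag_extend_add add.assoc)
    then show "z \<in> {b + ?g c | b. b \<in> ?B}"
      using Badd[OF _ gA] by blast
  next
    fix z assume "z \<in> {b + ?g c | b. b \<in> ?B}"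
    then obtain b where "b \<in> ?B" "z = b + ?g (0 + c)" by auto
    then show "z \<in> {b + ?g (a + c) | a b. a \<in> ?A \<and> b \<in> ?B}"
      using A0 by blast
  qed
  also have "\<dots> = ?B #>\<^bsub>tensor_free N' M\<^esub> ?g c"
    unfolding r_coset_def tensor_free_simps by blast
  finally show ?thesis .
qed

end

theory Submission
  imports Defs
begin

text \<open>Tensoring the inclusion of an ideal \<open>K\<close> into \<open>R\<close> with the flat module \<open>R/I\<close> shows
  \<open>K \<inter> I = K \<cdot> I\<close>: for \<open>a \<in> K \<inter> I\<close> the element \<open>a \<otimes> 1\<close> vanishes in \<open>R \<otimes> R/I\<close>, hence in
  \<open>K \<otimes> R/I\<close>, which maps to \<open>R/(K \<cdot> I)\<close>. Taking \<open>K = (a)\<close>, every \<open>a \<in> I\<close> has the form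
  \<open>a = a b\<close> with \<open>b \<in> I\<close>. Since \<open>V(I) = V(J)\<close>, some power of \<open>b\<close> lies in \<open>J\<close>, and
  \<open>a = a b\<^sup>n \<in> J\<close>. Conversely, if \<open>a \<in> J\<close> then some \<open>a\<^sup>n\<close> lies in \<open>I\<close>, so
  \<open>a\<^sup>n (1 - b) = 0\<close> for some \<open>b \<in> I\<close>; reducedness gives \<open>a (1 - b) = 0\<close>, that is \<open>a = a b \<in> I\<close>.\<close>

section \<open>Prime ideals and powers of an element\<close>

text \<open>If neither \<open>a\<close> nor \<open>b\<close> lies in \<open>P\<close>, maximality
  puts a power of \<open>x\<close> into each of P + (a) and P + (b). When \<open>a b\<close> lies in
  \<open>P\<close>, the product of these two powers is a power of \<open>x\<close> in
  \<open>P\<close>, a contradiction.\<close>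

lemma (in cring) maximal_avoiding_powers_prime:
  assumes P: "ideal P R" and x: "x \<in> carrier R"
    and avoid: "\<And>n::nat. x [^] n \<notin> P"
    and maximal: "\<And>Q. ideal Q R \<Longrightarrow> P \<subset> Q \<Longrightarrow> \<exists>n::nat. x [^] n \<in> Q"
  shows "primeideal P R"
proof (rule primeidealI[OF P is_cring])
  interpret P: ideal P R by (rule P)
  \<comment> \<open>The avoided power with exponent 0 is the unit, so \<open>P\<close> is
    proper.\<close>
  show "carrier R \<noteq> P"
    using avoid[of 0] by auto
  have power: "\<exists>n::nat. \<exists>p\<in>P. \<exists>r\<in>carrier R. x [^] n = p \<oplus> r \<otimes> a"
    if a: "a \<in> carrier R" "a \<notin> P" for a
  proof -
    have "ideal (P <+>\<^bsub>R\<^esub> PIdl a) R"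
      by (intro add_ideals P cgenideal_ideal a)
    moreover have "P \<subset> P <+>\<^bsub>R\<^esub> PIdl a"
    proof (intro psubsetI subsetI)
      interpret A: ideal "PIdl a" R by (intro cgenideal_ideal a)
      have sum: "p \<oplus> q \<in> P <+>\<^bsub>R\<^esub> PIdl a" if "p \<in> P" "q \<in> PIdl a" for p q
        unfolding set_add_def' using that by blast
      show "p \<in> P <+>\<^bsub>R\<^esub> PIdl a" if "p \<in> P" for p
        using sum[OF that A.zero_closed] P.Icarr[OF that] by simp
      have "a \<in> P <+>\<^bsub>R\<^esub> PIdl a"
        using sum[OF P.zero_closed cgenideal_self[OF a(1)]] a(1) by simp
      then show "P \<noteq> P <+>\<^bsub>R\<^esub> PIdl a"
        using a(2) by blast
    qed
    ultimately obtain n :: nat where "x [^] n \<in> P <+>\<^bsub>R\<^esub> PIdl a"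
      using maximal by blast
    then show ?thesis
      unfolding set_add_def' cgenideal_def by blast
  qed
  fix a b assume a: "a \<in> carrier R" and b: "b \<in> carrier R" and ab: "a \<otimes> b \<in> P"
  show "a \<in> P \<or> b \<in> P"
  proof (rule ccontr)
    assume "\<not> (a \<in> P \<or> b \<in> P)"
    then obtain m n :: nat and p q r s
      where p: "p \<in> P" and r: "r \<in> carrier R" and m: "x [^] m = p \<oplus> r \<otimes> a"
        and q: "q \<in> P" and s: "s \<in> carrier R" and n: "x [^] n = q \<oplus> s \<otimes> b"
      using power a b by metis
    note [simp] = a b r s P.Icarr[OF p] P.Icarr[OF q]
    \<comment> \<open>The terms are grouped so that each has a factor in \<open>P\<close>:
      \<open>p\<close>, \<open>q\<close> or \<open>a \<otimes> b\<close>.\<close>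
    have "x [^] (m + n) = p \<otimes> (q \<oplus> s \<otimes> b) \<oplus> ((r \<otimes> a) \<otimes> q \<oplus> (r \<otimes> s) \<otimes> (a \<otimes> b))"
      by (simp add: nat_pow_mult[OF x, symmetric] m n l_distr r_distr m_ac a_ac)
    also have "\<dots> \<in> P"
      by (intro P.a_closed P.I_r_closed P.I_l_closed p q ab) simp_all
    finally show False
      using avoid by blast
  qed
qed

text \<open>This is the nontrivial half of the description of the radical of \<open>J\<close> as the
  intersection of V(J). If no power of \<open>x\<close> lies in \<open>J\<close>, Zorn's lemma gives
  an ideal maximal among those that contain \<open>J\<close> and avoid all powers of
  \<open>x\<close>. It is prime, so it would have to contain \<open>x\<close>.\<close>

lemma (in cring) power_mem_ideal_if_mem_primes:
  assumes J: "ideal J R" and x: "x \<in> carrier R"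
    and primes: "\<And>P. P \<in> zero_locus R J \<Longrightarrow> x \<in> P"
  shows "\<exists>n::nat. x [^] n \<in> J"
proof (rule ccontr)
  assume none: "\<nexists>n::nat. x [^] n \<in> J"
  define A where "A = {Q. ideal Q R \<and> J \<subseteq> Q \<and> (\<forall>n::nat. x [^] n \<notin> Q)}"
  have "J \<in> A"
    using J none by (simp add: A_def)
  then have "A \<noteq> {}" by blast
  moreover have "\<Union>C \<in> A" if C: "C \<noteq> {}" "subset.chain A C" for C
  proof -
    have "subset.chain {Q. ideal Q R} C"
      using C(2) unfolding pred_on.chain_def A_def by blast
    from chain_Union_is_ideal[OF this] C(1) have "ideal (\<Union>C) R" by simp
    then show ?thesis
      using C unfolding pred_on.chain_def A_def by blast
  qed
  ultimately obtain P where P: "P \<in> A" and max: "\<And>Q. Q \<in> A \<Longrightarrow> P \<subseteq> Q \<Longrightarrow> Q = P"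
    using subset_Zorn_nonempty[of A] by metis
  have "primeideal P R"
  proof (rule maximal_avoiding_powers_prime)
    fix Q assume "ideal Q R" "P \<subset> Q"
    then show "\<exists>n::nat. x [^] n \<in> Q"
      using P max unfolding A_def by blast
  qed (use P x in \<open>auto simp: A_def\<close>)
  then have "P \<in> zero_locus R J"
    using P by (simp add: A_def zero_locus_def Spec_def)
  with primes have "x [^] (1::nat) \<in> P" using x by simp
  with P show False unfolding A_def by blast
qed

section \<open>Tensor products and ideals as test modules\<close>

text \<open>The extension of \<beta> to the free abelian group kills every defining relation, hence
  the subgroup they generate. Balanced maps thus turn the vanishing of a pure tensor into an
  equation in a concrete group.\<close>

lemma balanced_map_tensor_kernel:
  assumes N: "module R N" and M: "module R M" and G: "comm_group G"
    and closed: "\<And>x y. x \<in> carrier N \<Longrightarrow> y \<in> carrier M \<Longrightarrow> \<beta> x y \<in> carrier G"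
    and add_left: "\<And>x x' y. x \<in> carrier N \<Longrightarrow> x' \<in> carrier N \<Longrightarrow> y \<in> carrier M \<Longrightarrow>
      \<beta> (x \<oplus>\<^bsub>N\<^esub> x') y = \<beta> x y \<otimes>\<^bsub>G\<^esub> \<beta> x' y"
    and add_right: "\<And>x y y'. x \<in> carrier N \<Longrightarrow> y \<in> carrier M \<Longrightarrow> y' \<in> carrier M \<Longrightarrow>
      \<beta> x (y \<oplus>\<^bsub>M\<^esub> y') = \<beta> x y \<otimes>\<^bsub>G\<^esub> \<beta> x y'"
    and balanced: "\<And>r x y. r \<in> carrier R \<Longrightarrow> x \<in> carrier N \<Longrightarrow> y \<in> carrier M \<Longrightarrow>
      \<beta> (r \<odot>\<^bsub>N\<^esub> x) y = \<beta> x (r \<odot>\<^bsub>M\<^esub> y)"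
    and mem: "frag_of (x, y) \<in> tensor_kernel R N M"
    and x: "x \<in> carrier N" and y: "y \<in> carrier M"
  shows "\<beta> x y = \<one>\<^bsub>G\<^esub>"
proof -
  interpret G: comm_group G by (rule G)
  interpret N: module R N by (rule N)
  interpret M: module R M by (rule M)
  let ?F = "tensor_free N M"
  have sub: "case_prod \<beta> ` (carrier N \<times> carrier M) \<subseteq> carrier G"
    using closed by auto
  have "\<exists>h\<in>hom ?F G. \<forall>p\<in>carrier N \<times> carrier M. h (frag_of p) = case_prod \<beta> p"
    by (rule G.free_Abelian_group_universal[OF sub, folded tensor_free_def[of N M]]) blast
  then obtain h where h: "h \<in> hom ?F G"
    and h_of: "\<And>p. p \<in> carrier N \<times> carrier M \<Longrightarrow> h (frag_of p) = case_prod \<beta> p"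
    by blast
  interpret h: group_hom ?F G h
    using h by (intro group_hom.intro group_hom_axioms.intro G.is_group) (simp_all add: tensor_free_def)
  \<comment> \<open>This is the shape of the image of an additivity relation once \<beta> has been
    expanded on the sum.\<close>
  have cancel: "p \<otimes>\<^bsub>G\<^esub> q \<otimes>\<^bsub>G\<^esub> inv\<^bsub>G\<^esub> p \<otimes>\<^bsub>G\<^esub> inv\<^bsub>G\<^esub> q = \<one>\<^bsub>G\<^esub>"
    if "p \<in> carrier G" "q \<in> carrier G" for p q
    using that by (simp add: G.m_comm[of p q] G.m_assoc)
  have in_F: "frag_of (u, v) \<in> carrier ?F" if "u \<in> carrier N" "v \<in> carrier M" for u v
    using that by (simp add: tensor_free_simps)
  have diff: "h (a - b) = h a \<otimes>\<^bsub>G\<^esub> inv\<^bsub>G\<^esub> h b" and diff_closed: "a - b \<in> carrier ?F"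
    if "a \<in> carrier ?F" "b \<in> carrier ?F" for a b
  proof -
    have eq: "a - b = a \<otimes>\<^bsub>?F\<^esub> inv\<^bsub>?F\<^esub> b"
      using that by (simp add: tensor_free_simps(2,4))
    show "h (a - b) = h a \<otimes>\<^bsub>G\<^esub> inv\<^bsub>G\<^esub> h b" "a - b \<in> carrier ?F"
      unfolding eq using that by simp_all
  qed
  have relation: "h a = \<one>\<^bsub>G\<^esub>" if "a \<in> tensor_relations R N M" for a
    using that
  proof (cases rule: tensor_relations_cases)
    case (add1 u u' v)
    then show ?thesis
      by (simp add: diff diff_closed in_F h_of add_left closed cancel)
  next
    case (add2 u v v')
    then show ?thesis
      by (simp add: diff diff_closed in_F h_of add_right closed cancel)
  next
    case (smult r u v)
    then show ?thesis
      by (simp add: diff in_F h_of balanced closed)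
  qed
  have "h a = \<one>\<^bsub>G\<^esub>" if "a \<in> tensor_kernel R N M" for a
    using that unfolding tensor_kernel_def
  proof induction
    case (inv a)
    then show ?case
      using relation tensor_relations_subset[OF N M] by (simp add: subset_eq)
  next
    case (eng a b)
    then have "a \<in> carrier ?F" "b \<in> carrier ?F"
      using subgroup.subset[OF subgroup_tensor_kernel[OF N M]] by (auto simp: tensor_kernel_def)
    with eng show ?case by simp
  qed (simp_all add: relation)
  with mem show ?thesis
    using h_of[of "(x, y)"] x y by simp
qed

lemma frag_of_zero_in_tensor_kernel:
  assumes N: "module R N" and M: "module R M" and x: "x \<in> carrier N"
  shows "frag_of (x, \<zero>\<^bsub>M\<^esub>) \<in> tensor_kernel R N M"
proof -
  interpret M: module R M by (rule M)
  let ?a = "frag_of (x, \<zero>\<^bsub>M\<^esub> \<oplus>\<^bsub>M\<^esub> \<zero>\<^bsub>M\<^esub>) - frag_of (x, \<zero>\<^bsub>M\<^esub>) - frag_of (x, \<zero>\<^bsub>M\<^esub>)"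
  have a: "?a \<in> tensor_relations R N M"
    unfolding tensor_relations_def using x M.zero_closed by blast
  then have "inv\<^bsub>tensor_free N M\<^esub> ?a \<in> tensor_kernel R N M"
    unfolding tensor_kernel_def by (rule generate.inv)
  moreover have "?a \<in> carrier (tensor_free N M)"
    using a tensor_relations_subset[OF N M] by blast
  ultimately show ?thesis
    by (simp add: tensor_free_simps(4))
qed

text \<open>Flatness is tested only on modules with elements of type \<open>(nat \<Rightarrow> 'a) set\<close>, so the ideal
  has to be transported along an injection \<open>e\<close>. The ring multiplication of a module record is junk.\<close>

definition ideal_module ::
  "('a, 'm) ring_scheme \<Rightarrow> ('a \<Rightarrow> 'b) \<Rightarrow> 'a set \<Rightarrow> ('a, 'b) module" where
  "ideal_module R e K =
     \<lparr>carrier = e ` K,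
      monoid.mult = undefined, monoid.one = undefined,
      ring.zero = e \<zero>\<^bsub>R\<^esub>,
      ring.add = (\<lambda>x y. e (the_inv e x \<oplus>\<^bsub>R\<^esub> the_inv e y)),
      module.smult = (\<lambda>r x. e (r \<otimes>\<^bsub>R\<^esub> the_inv e x))\<rparr>"

lemma ideal_module_simps:
  assumes "inj e"
  shows "carrier (ideal_module R e K) = e ` K"
    and "\<zero>\<^bsub>ideal_module R e K\<^esub> = e \<zero>\<^bsub>R\<^esub>"
    and "e x \<oplus>\<^bsub>ideal_module R e K\<^esub> e y = e (x \<oplus>\<^bsub>R\<^esub> y)"
    and "r \<odot>\<^bsub>ideal_module R e K\<^esub> e x = e (r \<otimes>\<^bsub>R\<^esub> x)"
  by (simp_all add: ideal_module_def the_inv_f_f[OF assms])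

lemma (in cring) module_ideal_module:
  assumes "ideal K R" and e: "inj e"
  shows "module R (ideal_module R e K)"
proof -
  interpret K: ideal K R by fact
  show ?thesis
  proof (rule moduleI[OF is_cring])
    show "abelian_group (ideal_module R e K)"
    proof (rule abelian_groupI)
      fix x assume "x \<in> carrier (ideal_module R e K)"
      then obtain k where "k \<in> K" "x = e k"
        by (auto simp: ideal_module_simps[OF e])
      then show "\<exists>y\<in>carrier (ideal_module R e K).
          y \<oplus>\<^bsub>ideal_module R e K\<^esub> x = \<zero>\<^bsub>ideal_module R e K\<^esub>"
        by (auto simp: ideal_module_simps[OF e] l_neg K.Icarr intro!: bexI[of _ "\<ominus> k"])
    qed (auto simp: ideal_module_simps[OF e] K.Icarr a_ac)
  qed (auto simp: ideal_module_simps[OF e] K.Icarr K.I_l_closed l_distr r_distr m_assoc)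
qed

section \<open>Ideal products and flat quotients\<close>

lemma (in cring) flat_quotient_Int_subset_ideal_prod:
  assumes I: "ideal I R" and K: "ideal K R" and flat: "flat_module R (quotient_module R I)"
  shows "K \<inter> I \<subseteq> K \<cdot> I"
proof
  fix a assume "a \<in> K \<inter> I"
  then have aK: "a \<in> K" and aI: "a \<in> I" by auto
  interpret I: ideal I R by (rule I)
  interpret K: ideal K R by (rule K)
  have KI: "ideal (K \<cdot> I) R" by (rule ideal_prod_is_ideal[OF K I])
  interpret KI: ideal "K \<cdot> I" R by (rule KI)
  interpret Q: cring "R Quot (K \<cdot> I)" by (rule KI.quotient_is_cring[OF is_cring])
  note \<pi> = KI.rcos_ring_hom
  note [simp] = I.Icarr K.Icarr
  let ?M = "quotient_module R I"
  \<comment> \<open>Singletons of constant sequences embed the ring into the element type of the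
    test modules.\<close>
  define e :: "'a \<Rightarrow> (nat \<Rightarrow> 'a) set" where "e = (\<lambda>x. {\<lambda>_. x})"
  have e: "inj e"
    by (rule injI) (auto simp: e_def fun_eq_iff)
  note e_simps = ideal_module_simps[OF e]
  let ?N = "ideal_module R e K" and ?N' = "ideal_module R e (carrier R)"
  have N: "module R ?N" and N': "module R ?N'"
    by (intro module_ideal_module K oneideal e)+
  have M: "module R ?M" by (rule module_quotient_module[OF is_cring I])
  interpret kernel: subgroup "tensor_kernel R ?N ?M" "tensor_free ?N ?M"
    by (rule subgroup_tensor_kernel[OF N M])
  interpret kernel': subgroup "tensor_kernel R ?N' ?M" "tensor_free ?N' ?M"
    by (rule subgroup_tensor_kernel[OF N' M])
  have carrier_M: "carrier ?M = (\<lambda>t. I +> t) ` carrier R"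
    by (auto simp: quotient_module_simps FactRing_def A_RCOSETS_def')
  have groups: "group (tensor_free ?N ?M)" "group (tensor_free ?N' ?M)"
    by (simp_all add: tensor_free_def)
  \<comment> \<open>Both copies are formed with the same \<open>e\<close>, so the inclusion of
    \<open>K\<close> into the ring becomes \<open>id\<close>.\<close>
  have f: "id \<in> module_homs R ?N ?N'"
    by (auto simp: module_homs_def e_simps)
  let ?u = "frag_of (e a, I +> \<one>)"
  have u: "?u \<in> carrier (tensor_free ?N ?M)" "?u \<in> carrier (tensor_free ?N' ?M)"
    using aK by (auto simp: tensor_free_simps e_simps carrier_M)
  have z: "0 \<in> carrier (tensor_free ?N ?M)"
    by (simp add: tensor_free_simps)
  \<comment> \<open>Over the whole ring the scalar \<open>a\<close> can be moved across the tensor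
    sign: a \<otimes> 1 = 1 \<otimes> (a 1), and \<open>a\<close> acts on the class of 1 as zero. In
    \<open>K\<close> the left factor 1 may be missing, which is where flatness enters.\<close>
  have u': "?u \<in> tensor_kernel R ?N' ?M"
  proof -
    have zero: "a \<odot>\<^bsub>?M\<^esub> (I +> \<one>) = \<zero>\<^bsub>?M\<^esub>"
      by (simp add: quotient_module_simps I.rcoset_mult_add FactRing_def aI)
         (rule a_rcos_zero[OF I aI])
    have "frag_of (a \<odot>\<^bsub>?N'\<^esub> e \<one>, I +> \<one>) - frag_of (e \<one>, a \<odot>\<^bsub>?M\<^esub> (I +> \<one>))
        \<in> tensor_relations R ?N' ?M"
    proof -
      have "e \<one> \<in> carrier ?N'" "I +> \<one> \<in> carrier ?M" "a \<in> carrier R"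
        using aI by (auto simp: e_simps carrier_M)
      then show ?thesis unfolding tensor_relations_def by blast
    qed
    then have "?u - frag_of (e \<one>, \<zero>\<^bsub>?M\<^esub>) \<in> tensor_kernel R ?N' ?M"
      using aI by (auto simp: zero e_simps tensor_kernel_def intro: generate.incl)
    moreover have "frag_of (e \<one>, \<zero>\<^bsub>?M\<^esub>) \<in> tensor_kernel R ?N' ?M"
      by (rule frag_of_zero_in_tensor_kernel[OF N' M]) (simp add: e_simps)
    ultimately show ?thesis
      using kernel'.m_closed by (fastforce simp: tensor_free_simps(2))
  qed
  have "inj_on (tensor_map R ?N' ?M id) (carrier (tensor_product R ?N ?M))"
    by (rule flat[unfolded flat_module_def, THEN conjunct2, rule_format]) (simp add: N N' f)
  moreover have "tensor_map R ?N' ?M id (tensor_kernel R ?N ?M #>\<^bsub>tensor_free ?N ?M\<^esub> ?u)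
      = tensor_map R ?N' ?M id (tensor_kernel R ?N ?M #>\<^bsub>tensor_free ?N ?M\<^esub> 0)"
  proof -
    have "0 \<in> tensor_kernel R ?N' ?M"
      using kernel'.one_closed by (simp add: tensor_free_simps(3))
    then show ?thesis
      using u' by (simp add: tensor_map_coset[OF N N' M f] kernel'.rcos_const[OF groups(2)])
  qed
  ultimately have "tensor_kernel R ?N ?M #>\<^bsub>tensor_free ?N ?M\<^esub> ?u
      = tensor_kernel R ?N ?M #>\<^bsub>tensor_free ?N ?M\<^esub> 0"
    by (rule inj_onD) (use u z in \<open>auto simp: tensor_product_def FactGroup_def RCOSETS_def\<close>)
  then have u_kernel: "?u \<in> tensor_kernel R ?N ?M"
    using group.rcos_self[OF groups(1) u(1) kernel.subgroup_axioms] group.coset_mult_one[OF groups(1) kernel.subset]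
    by (simp add: tensor_free_simps(3))
  \<comment> \<open>On pure tensors this is multiplication from K \<otimes> R/I to R/(K I), with a
    chosen representative of the coset. Another choice changes the product by some
    \<open>x \<otimes> i\<close> with \<open>x\<close> in \<open>K\<close> and \<open>i\<close> in
    \<open>I\<close>, which lies in \<open>K \<cdot> I\<close>.\<close>
  define \<beta> where "\<beta> x T = (K \<cdot> I) +> (the_inv e x \<otimes> (SOME t. t \<in> T))" for x T
  have \<beta>: "\<beta> (e x) (I +> t) = (K \<cdot> I) +> (x \<otimes> t)" if x: "x \<in> K" and t: "t \<in> carrier R" for x t
  proof -
    have "(SOME s. s \<in> I +> t) \<in> I +> t"
      by (rule someI) (rule I.a_rcos_self[OF t])
    then obtain i where i: "i \<in> I" "(SOME s. s \<in> I +> t) = i \<oplus> t"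
      unfolding a_r_coset_def' by blast
    have "x \<otimes> (i \<oplus> t) \<ominus> x \<otimes> t = x \<otimes> i"
      using x t i(1) by (simp add: r_distr minus_eq a_assoc r_neg)
    also have "\<dots> \<in> K \<cdot> I"
      using x i(1) by (rule ideal_prod.prod)
    finally have "(K \<cdot> I) +> (x \<otimes> (i \<oplus> t)) = (K \<cdot> I) +> (x \<otimes> t)"
      using quotient_eq_iff_same_a_r_cos[OF KI] x t i(1) by simp
    then show ?thesis
      by (simp add: \<beta>_def i(2) the_inv_f_f[OF e])
  qed
  have "\<beta> (e a) (I +> \<one>) = \<one>\<^bsub>add_monoid (R Quot (K \<cdot> I))\<^esub>"
  proof (rule balanced_map_tensor_kernel[OF N M Q.a_comm_group _ _ _ _ u_kernel])
    fix r x y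
    assume r: "r \<in> carrier R" and "x \<in> carrier ?N" "y \<in> carrier ?M"
    then obtain k t where k: "k \<in> K" "x = e k" and t: "t \<in> carrier R" "y = I +> t"
      by (auto simp: e_simps carrier_M)
    have "r \<odot>\<^bsub>?M\<^esub> y = I +> r \<otimes> t"
      using r t by (simp add: quotient_module_simps FactRing_def I.rcoset_mult_add)
    moreover have "r \<otimes> k \<otimes> t = k \<otimes> (r \<otimes> t)"
      using r k(1) t(1) by (simp add: m_ac)
    ultimately show "\<beta> (r \<odot>\<^bsub>?N\<^esub> x) y = \<beta> x (r \<odot>\<^bsub>?M\<^esub> y)"
      using r k t by (simp add: e_simps \<beta> K.I_l_closed)
  qed (use aK in \<open>auto simp: e_simps carrier_M \<beta> quotient_module_simps FactRing_simps l_distr r_distr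
         I.a_rcos_sum KI.a_rcos_sum a_rcosetsI KI.a_subset\<close>)
  then have "(K \<cdot> I) +> a = K \<cdot> I"
    using aK by (simp add: \<beta> FactRing_def)
  then show "a \<in> K \<cdot> I"
    using KI.a_rcos_self[of a] aK by simp
qed

text \<open>A generating product (r a) j equals a (r j), and a b + a c = a (b + c), so sums of
  products collapse to a single multiple of \<open>a\<close>.\<close>

lemma (in cring) cgenideal_prod_subset:
  assumes I: "ideal I R" and a: "a \<in> carrier R"
  shows "(PIdl a) \<cdot> I \<subseteq> {a \<otimes> b | b. b \<in> I}"
proof
  interpret I: ideal I R by (rule I)
  fix x assume "x \<in> (PIdl a) \<cdot> I"
  then show "x \<in> {a \<otimes> b | b. b \<in> I}"
  proof induction
    case (prod i j)
    then obtain r where "r \<in> carrier R" "i = r \<otimes> a"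
      unfolding cgenideal_def by blast
    with prod a have "i \<otimes> j = a \<otimes> (r \<otimes> j)"
      by (simp add: I.Icarr m_ac)
    moreover have "r \<otimes> j \<in> I"
      by (rule I.I_l_closed) fact+
    ultimately show ?case by blast
  next
    case (sum x y)
    then obtain b c where "b \<in> I" "c \<in> I" "x = a \<otimes> b" "y = a \<otimes> c" by blast
    with a show ?case
      by (auto intro!: exI[of _ "b \<oplus> c"] simp: I.Icarr r_distr)
  qed
qed

lemma (in cring) flat_quotient_mem_obtains:
  assumes I: "ideal I R" and flat: "flat_module R (quotient_module R I)" and a: "a \<in> I"
  obtains b where "b \<in> I" "a = a \<otimes> b"
proof -
  interpret I: ideal I R by (rule I)
  have "a \<in> PIdl a \<inter> I"
    using a cgenideal_self by simp
  then show thesis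
    using flat_quotient_Int_subset_ideal_prod[OF I cgenideal_ideal flat, of a]
      cgenideal_prod_subset[OF I, of a] that a I.Icarr by blast
qed

section \<open>Ideals with the same zero locus\<close>

theorem corollary3p6:
  fixes R :: "('a, 'm) ring_scheme" and I J :: "'a set"
  assumes "reduced_ring R"
    and "ideal I R" and "ideal J R"
    and "flat_module R (quotient_module R I)"
    and "zero_locus R I = zero_locus R J"
  shows "I = J"
proof -
  interpret cring R using assms(1) by (simp add: reduced_ring_def)
  interpret I: ideal I R by fact
  interpret J: ideal J R by fact
  have reduced: "x = \<zero>\<^bsub>R\<^esub>" if "x \<in> carrier R" "x [^]\<^bsub>R\<^esub> (n::nat) = \<zero>\<^bsub>R\<^esub>" for x n
    using assms(1) that by (auto simp: reduced_ring_def)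
  show ?thesis
  proof (intro equalityI subsetI)
    fix a assume a: "a \<in> I"
    obtain b where b: "b \<in> I" "a = a \<otimes>\<^bsub>R\<^esub> b"
      by (rule flat_quotient_mem_obtains[OF assms(2,4) a])
    have "b \<in> P" if "P \<in> zero_locus R J" for P
    proof -
      from that have "P \<in> zero_locus R I" by (simp only: assms(5))
      with b(1) show ?thesis by (auto simp: zero_locus_def)
    qed
    then obtain n :: nat where n: "b [^]\<^bsub>R\<^esub> n \<in> J"
      using power_mem_ideal_if_mem_primes[OF assms(3) I.Icarr[OF b(1)]] by metis
    \<comment> \<open>Multiplication by \<open>b\<close> fixes \<open>a\<close>, so every power of
      \<open>b\<close> does; the power lying in \<open>J\<close> then carries \<open>a\<close> into
      \<open>J\<close>.\<close>
    have "a = a \<otimes>\<^bsub>R\<^esub> b [^]\<^bsub>R\<^esub> k" for k :: nat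
    proof (induction k)
      case (Suc k)
      have "a \<otimes>\<^bsub>R\<^esub> b [^]\<^bsub>R\<^esub> Suc k = (a \<otimes>\<^bsub>R\<^esub> b [^]\<^bsub>R\<^esub> k) \<otimes>\<^bsub>R\<^esub> b"
        using a b(1) by (simp add: I.Icarr m_assoc)
      also have "\<dots> = a"
        by (simp only: Suc[symmetric] b(2)[symmetric])
      finally show ?case by (rule sym)
    qed (use a in \<open>simp add: I.Icarr\<close>)
    from this[of n, symmetric] show "a \<in> J"
      using J.I_l_closed[OF n I.Icarr[OF a]] by simp
  next
    fix a assume a: "a \<in> J"
    have [simp]: "a \<in> carrier R" using a by (rule J.Icarr)
    have "a \<in> P" if "P \<in> zero_locus R I" for P
    proof -
      from that have "P \<in> zero_locus R J" by (simp only: assms(5))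
      with a show ?thesis by (auto simp: zero_locus_def)
    qed
    then obtain n :: nat where n: "a [^]\<^bsub>R\<^esub> n \<in> I"
      using power_mem_ideal_if_mem_primes[OF assms(2) J.Icarr[OF a]] by metis
    then obtain b where b: "b \<in> I" "a [^]\<^bsub>R\<^esub> n = a [^]\<^bsub>R\<^esub> n \<otimes>\<^bsub>R\<^esub> b"
      by (rule flat_quotient_mem_obtains[OF assms(2,4)])
    note [simp] = I.Icarr[OF b(1)]
    define c where "c = \<one>\<^bsub>R\<^esub> \<ominus>\<^bsub>R\<^esub> b"
    have c [simp]: "c \<in> carrier R" by (simp add: c_def)
    have "a [^]\<^bsub>R\<^esub> n \<otimes>\<^bsub>R\<^esub> c = a [^]\<^bsub>R\<^esub> n \<ominus>\<^bsub>R\<^esub> a [^]\<^bsub>R\<^esub> n \<otimes>\<^bsub>R\<^esub> b"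
      by (simp add: c_def minus_eq r_distr r_minus)
    also have "\<dots> = \<zero>\<^bsub>R\<^esub>"
      by (simp add: b(2)[symmetric] minus_eq r_neg)
    finally have zero: "a [^]\<^bsub>R\<^esub> n \<otimes>\<^bsub>R\<^esub> c = \<zero>\<^bsub>R\<^esub>" .
    have "(a \<otimes>\<^bsub>R\<^esub> c) [^]\<^bsub>R\<^esub> Suc n = (a [^]\<^bsub>R\<^esub> n \<otimes>\<^bsub>R\<^esub> c) \<otimes>\<^bsub>R\<^esub> (a \<otimes>\<^bsub>R\<^esub> c [^]\<^bsub>R\<^esub> n)"
      by (simp add: nat_pow_distrib m_ac)
    then have "a \<otimes>\<^bsub>R\<^esub> c = \<zero>\<^bsub>R\<^esub>"
      by (intro reduced[of "a \<otimes>\<^bsub>R\<^esub> c" "Suc n"]) (simp_all add: zero del: nat_pow_Suc)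
    then have "a \<ominus>\<^bsub>R\<^esub> a \<otimes>\<^bsub>R\<^esub> b = \<zero>\<^bsub>R\<^esub>"
      by (simp add: c_def minus_eq r_distr r_minus)
    then have "a \<otimes>\<^bsub>R\<^esub> b = a"
      by simp
    moreover have "a \<otimes>\<^bsub>R\<^esub> b \<in> I"
      by (rule I.I_l_closed[OF b(1)]) simp
    ultimately show "a \<in> I"
      by simp
  qed
qed

end
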